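(* For every game $G$, the tipping points $\mathrm{ltp}(G)$, $\mathrm{rtp}(G)$ and $\mathrm{ntp}(G)$ all exist.
   Context: Games are short misère-play game forms, possibly augmented in Siegel's sense (subpositions may carry Left and/or Right tombstones; a Left (Right) tombstone means Left (Right) wins moving first there). Outcomes $o(G)\in\{\mathscr{L},\mathscr{N},\mathscr{P},\mathscr{R}\}$. $+$ is disjunctive sum; for $n\ge1$ the integer $n$ is $\{n-1\mid\cdot\}$ (with $0=\{\cdot\mid\cdot\}$) and $\overline{n}$ is its conjugate. Definitions: $\mathrm{ntp}(G)$ is the smallest integer $m\ge0$ such that $o(G+m)=\mathscr{N}$ or $o(G+\overline{m})=\mathscr{N}$; $\mathrm{rtp}(G)$ is the smallest integer $m\ge0$ with $o(G+m)=\mathscr{R}$; $\mathrm{ltp}(G)$ is the smallest integer $m\ge0$ with $o(G+\overline{m})=\mathscr{L}$. "Exist" means the respective sets of such $m$ are nonempty. *)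

theory Defs
  imports Main "HOL-Library.FSet"
begin

text \<open>
  Short augmented game forms. The two Booleans record whether the position itself carries a Left,
  respectively Right, tombstone; ordinary game forms are those with no tombstone anywhere.
\<close>

datatype game =
  Game (lopts: "game fset") (ropts: "game fset") (ltomb: bool) (rtomb: bool)

definition left_end_like :: "game \<Rightarrow> bool" where
  "left_end_like G \<longleftrightarrow> lopts G = {||} \<or> ltomb G"

definition right_end_like :: "game \<Rightarrow> bool" where
  "right_end_like G \<longleftrightarrow> ropts G = {||} \<or> rtomb G"

lemma size_lopts: "X |\<in>| lopts G \<Longrightarrow> size X < size G"
proof (cases G)
  case (Game A B a b)
  assume "X |\<in>| lopts G"
  with Game have "Suc (size X) \<le> (\<Sum>x\<in>fset A. Suc (size x))"
    by (intro member_le_sum) auto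
  with Game show ?thesis by simp
qed

lemma size_ropts: "X |\<in>| ropts G \<Longrightarrow> size X < size G"
proof (cases G)
  case (Game A B a b)
  assume "X |\<in>| ropts G"
  with Game have "Suc (size X) \<le> (\<Sum>x\<in>fset B. Suc (size x))"
    by (intro member_le_sum) auto
  with Game show ?thesis by simp
qed

text \<open>
  Misere play: a player to move who has no option wins, and so does one to move at a position
  carrying that player's tombstone.
\<close>

function left_wins_first :: "game \<Rightarrow> bool" and right_wins_first :: "game \<Rightarrow> bool" where
  "left_wins_first G \<longleftrightarrow> left_end_like G \<or> (\<exists>X |\<in>| lopts G. \<not> right_wins_first X)"
| "right_wins_first G \<longleftrightarrow> right_end_like G \<or> (\<exists>X |\<in>| ropts G. \<not> left_wins_first X)"
  by pat_completeness auto
termination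
  by (relation "measure (case_sum size size)") (auto simp: size_lopts size_ropts)

declare left_wins_first.simps [simp del] right_wins_first.simps [simp del]

datatype outcome = L_outcome | N_outcome | P_outcome | R_outcome

definition outcome :: "game \<Rightarrow> outcome" where
  "outcome G =
     (if left_wins_first G
      then (if right_wins_first G then N_outcome else L_outcome)
      else (if right_wins_first G then R_outcome else P_outcome))"

text \<open>
  Disjunctive sum. Following Siegel, a sum carries a Left tombstone iff one summand does and both
  summands are Left end-like (that is, the other one has a Left tombstone or no Left option);
  symmetrically for Right. A tombstone of a single summand does not by itself pass to the sum.
\<close>

function gsum :: "game \<Rightarrow> game \<Rightarrow> game" (infixl "\<oplus>" 65) where
  "G \<oplus> H = Game
     ((\<lambda>X. X \<oplus> H) |`| lopts G |\<union>| (\<lambda>Y. G \<oplus> Y) |`| lopts H)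
     ((\<lambda>X. X \<oplus> H) |`| ropts G |\<union>| (\<lambda>Y. G \<oplus> Y) |`| ropts H)
     ((ltomb G \<or> ltomb H) \<and> left_end_like G \<and> left_end_like H)
     ((rtomb G \<or> rtomb H) \<and> right_end_like G \<and> right_end_like H)"
  by pat_completeness auto
termination
  by (relation "measure (\<lambda>(G, H). size G + size H)") (auto simp: size_lopts size_ropts)

declare gsum.simps [simp del]

primrec conjugate :: "game \<Rightarrow> game" where
  "conjugate (Game A B a b) = Game (conjugate |`| B) (conjugate |`| A) b a"

primrec int_game :: "nat \<Rightarrow> game" where
  "int_game 0 = Game {||} {||} False False"
| "int_game (Suc n) = Game {|int_game n|} {||} False False"

definition smallest :: "(nat \<Rightarrow> bool) \<Rightarrow> nat option" where
  "smallest P = (if \<exists>m. P m then Some (LEAST m. P m) else None)"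

definition ntp :: "game \<Rightarrow> nat option" where
  "ntp G = smallest (\<lambda>m. outcome (G \<oplus> int_game m) = N_outcome
                       \<or> outcome (G \<oplus> conjugate (int_game m)) = N_outcome)"

definition rtp :: "game \<Rightarrow> nat option" where
  "rtp G = smallest (\<lambda>m. outcome (G \<oplus> int_game m) = R_outcome)"

definition ltp :: "game \<Rightarrow> nat option" where
  "ltp G = smallest (\<lambda>m. outcome (G \<oplus> conjugate (int_game m)) = L_outcome)"

end

theory Submission
  imports Defs
begin

text \<open>
  If \<open>m\<close> is at least the size of \<open>G\<close>, then in \<open>G \<oplus> m\<close> Right plays only in the component
  starting at \<open>G\<close> and runs out of moves there before Left can exhaust \<open>m\<close>; a Left tombstone in
  that component is harmless while \<open>m > 0\<close>. So \<open>G \<oplus> m\<close> has outcome R for large \<open>m\<close>. If Right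
  does not win \<open>G\<close> moving first, take the least \<open>m\<close> for which Right wins \<open>G \<oplus> m\<close> moving first:
  Left, moving first there, wins by moving to \<open>G \<oplus> (m - 1)\<close>, so the outcome is N.
  Conjugation gives the remaining claims.
\<close>

lemma lopts_gsum: "lopts (G \<oplus> H) = (\<lambda>X. X \<oplus> H) |`| lopts G |\<union>| (\<lambda>Y. G \<oplus> Y) |`| lopts H"
  and ropts_gsum: "ropts (G \<oplus> H) = (\<lambda>X. X \<oplus> H) |`| ropts G |\<union>| (\<lambda>Y. G \<oplus> Y) |`| ropts H"
  and ltomb_gsum: "ltomb (G \<oplus> H) \<longleftrightarrow> (ltomb G \<or> ltomb H) \<and> left_end_like G \<and> left_end_like H"
  and rtomb_gsum: "rtomb (G \<oplus> H) \<longleftrightarrow> (rtomb G \<or> rtomb H) \<and> right_end_like G \<and> right_end_like H"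
  by (subst gsum.simps, simp)+

text \<open>If both summands are Left end-like, either one of them has a tombstone, which the sum
  then inherits, or neither has a Left option, and so neither does the sum. Conversely, a sum
  without Left options has summands without Left options.\<close>

lemma left_end_like_gsum: "left_end_like (G \<oplus> H) \<longleftrightarrow> left_end_like G \<and> left_end_like H"
  by (auto simp: left_end_like_def lopts_gsum ltomb_gsum)

lemma right_end_like_gsum: "right_end_like (G \<oplus> H) \<longleftrightarrow> right_end_like G \<and> right_end_like H"
  by (auto simp: right_end_like_def ropts_gsum rtomb_gsum)

lemma conjugate_sel [simp]:
  "lopts (conjugate G) = conjugate |`| ropts G"
  "ropts (conjugate G) = conjugate |`| lopts G"
  "ltomb (conjugate G) = rtomb G"
  "rtomb (conjugate G) = ltomb G"
  by (cases G; simp)+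

lemma conjugate_end_like [simp]:
  "left_end_like (conjugate G) \<longleftrightarrow> right_end_like G"
  "right_end_like (conjugate G) \<longleftrightarrow> left_end_like G"
  by (simp_all add: left_end_like_def right_end_like_def)

lemma conjugate_conjugate [simp]: "conjugate (conjugate G) = G"
proof (induction G)
  case (Game A B a b)
  have "(\<lambda>X. conjugate (conjugate X)) |`| A = (\<lambda>X. X) |`| A"
    "(\<lambda>X. conjugate (conjugate X)) |`| B = (\<lambda>X. X) |`| B"
    using Game by (auto intro!: fset.map_cong0)
  then show ?case by (simp add: comp_def)
qed

lemma conjugate_gsum: "conjugate (G \<oplus> H) = conjugate G \<oplus> conjugate H"
proof (induction G H rule: gsum.induct)
  case (1 G H)
  have IH: "conjugate (X \<oplus> H) = conjugate X \<oplus> conjugate H"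
    if "X |\<in>| lopts G \<or> X |\<in>| ropts G" for X
    using 1 that by blast
  have IH': "conjugate (G \<oplus> Y) = conjugate G \<oplus> conjugate Y"
    if "Y |\<in>| lopts H \<or> Y |\<in>| ropts H" for Y
    using 1 that by blast
  have L: "lopts (conjugate (G \<oplus> H)) = lopts (conjugate G \<oplus> conjugate H)"
    using IH IH' by (simp add: lopts_gsum ropts_gsum fimage_funion comp_def
        cong: fset.map_cong)
  have R: "ropts (conjugate (G \<oplus> H)) = ropts (conjugate G \<oplus> conjugate H)"
    using IH IH' by (simp add: lopts_gsum ropts_gsum fimage_funion comp_def
        cong: fset.map_cong)
  have "ltomb (conjugate (G \<oplus> H)) = ltomb (conjugate G \<oplus> conjugate H)"
    "rtomb (conjugate (G \<oplus> H)) = rtomb (conjugate G \<oplus> conjugate H)"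
    by (simp_all add: ltomb_gsum rtomb_gsum)
  with L R show ?case by (intro game.expand conjI)
qed

text \<open>The two claims are proved together because a move passes the turn: each claim for
  \<open>G\<close> rests on the other one for the options of \<open>G\<close>.\<close>

lemma wins_first_conjugate:
  "left_wins_first (conjugate G) \<longleftrightarrow> right_wins_first G"
  "right_wins_first (conjugate G) \<longleftrightarrow> left_wins_first G"
proof (induction G rule: measure_induct_rule [of size])
  case (less G)
  {
    case 1
    have "right_wins_first (conjugate X) \<longleftrightarrow> left_wins_first X" if "X |\<in>| ropts G" for X
      using less(2) size_ropts that by blast
    then show ?case
      by (subst left_wins_first.simps, subst right_wins_first.simps) auto
  next
    case 2
    have "left_wins_first (conjugate X) \<longleftrightarrow> right_wins_first X" if "X |\<in>| lopts G" for X
      using less(1) size_lopts that by blast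
    then show ?case
      by (subst right_wins_first.simps, subst left_wins_first.simps) auto
  }
qed

lemma outcome_conjugate:
  "outcome (conjugate G) = L_outcome \<longleftrightarrow> outcome G = R_outcome"
  "outcome (conjugate G) = N_outcome \<longleftrightarrow> outcome G = N_outcome"
  by (simp_all add: outcome_def wins_first_conjugate)

text \<open>Turns sums with negative integers into conjugates of sums with positive ones, so that
  only \<open>int_game\<close> needs to be analysed.\<close>

lemma gsum_conjugate_eq: "G \<oplus> conjugate H = conjugate (conjugate G \<oplus> H)"
  by (simp add: conjugate_gsum)

lemma right_end_like_int_game [simp]: "right_end_like (int_game m)"
  by (cases m) (simp_all add: right_end_like_def)

lemma ropts_int_game [simp]: "ropts (int_game m) = {||}"
  by (cases m) simp_all

text \<open>The two bounds feed each other. Any move of Right shrinks \<open>G\<close>, so the weak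
  bound becomes strict; a move of Left lowers \<open>m\<close> by one or shrinks \<open>G\<close>,
  so the strict bound still gives the weak one.\<close>

lemma wins_first_gsum_int_game:
  "size G \<le> m \<Longrightarrow> right_wins_first (G \<oplus> int_game m)"
  "size G < m \<Longrightarrow> \<not> left_wins_first (G \<oplus> int_game m)"
proof (induction "size G + m" arbitrary: G m rule: less_induct)
  case less
  {
    case 1
    show ?case
    proof (cases "right_end_like G")
      case True
      then show ?thesis
        by (subst right_wins_first.simps) (simp add: right_end_like_gsum)
    next
      case False
      then obtain X where X: "X |\<in>| ropts G"
        by (auto simp: right_end_like_def)
      with 1 have "\<not> left_wins_first (X \<oplus> int_game m)"
        by (intro less(2)) (auto dest: size_ropts)
      with X show ?thesis
        by (subst right_wins_first.simps) (auto simp: ropts_gsum)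
    qed
  next
    case 2
    then obtain k where m: "m = Suc k"
      by (cases m) auto
    \<comment> \<open>As \<open>m\<close> is positive, \<open>int_game m\<close> has a Left option
      and no tombstone, so the sum is not Left end-like even if \<open>G\<close> is.\<close>
    have "\<not> left_end_like (G \<oplus> int_game m)"
      unfolding left_end_like_gsum by (simp add: m left_end_like_def)
    moreover have "right_wins_first (X \<oplus> int_game m)" if "X |\<in>| lopts G" for X
      using 2 size_lopts [OF that] by (intro less(1)) auto
    moreover have "right_wins_first (G \<oplus> int_game k)"
      using 2 m by (intro less(1)) auto
    ultimately show ?case
      by (subst left_wins_first.simps) (auto simp: lopts_gsum m)
  }
qed

lemma ex_outcome_R: "\<exists>m. outcome (G \<oplus> int_game m) = R_outcome"
  \<comment> \<open>The successor is taken because Left's loss needs the strict bound.\<close>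
  using wins_first_gsum_int_game [of G "Suc (size G)"]
  by (auto simp: outcome_def intro!: exI [of _ "Suc (size G)"])

lemma ex_outcome_N:
  assumes "\<not> right_wins_first (G \<oplus> int_game 0)"
  shows "\<exists>m. outcome (G \<oplus> int_game m) = N_outcome"
proof -
  have "\<exists>m. right_wins_first (G \<oplus> int_game m)"
    using wins_first_gsum_int_game(1) by blast
  \<comment> \<open>Right fails at 0 and succeeds somewhere, so by induction the change occurs
    between some \<open>k\<close> and \<open>Suc k\<close>.\<close>
  with assms obtain k where k: "\<not> right_wins_first (G \<oplus> int_game k)"
      "right_wins_first (G \<oplus> int_game (Suc k))"
    using nat_induct [of "\<lambda>m. \<not> right_wins_first (G \<oplus> int_game m)"] by blast
  have "left_wins_first (G \<oplus> int_game (Suc k))"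
    using k(1) by (subst left_wins_first.simps) (auto simp: lopts_gsum)
  with k(2) have "outcome (G \<oplus> int_game (Suc k)) = N_outcome"
    by (simp add: outcome_def)
  then show ?thesis ..
qed

lemma ex_smallest_iff: "(\<exists>n. smallest P = Some n) \<longleftrightarrow> (\<exists>m. P m)"
  by (simp add: smallest_def)

theorem theorem3p2:
  fixes G :: game
  shows "(\<exists>l. ltp G = Some l) \<and> (\<exists>r. rtp G = Some r) \<and> (\<exists>n. ntp G = Some n)"
proof (intro conjI)
  show "\<exists>l. ltp G = Some l"
    using ex_outcome_R [of "conjugate G"]
    by (simp add: ltp_def ex_smallest_iff gsum_conjugate_eq outcome_conjugate)
  show "\<exists>r. rtp G = Some r"
    using ex_outcome_R by (simp add: rtp_def ex_smallest_iff)
  have zero: "conjugate (int_game 0) = int_game 0"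
    by simp
  \<comment> \<open>Either Right or Left fails to win moving first, or 0 itself is a witness. Left's
    failure is read as Right's failure on the conjugate, which yields a witness for the negative
    integers since outcome N is invariant under conjugation.\<close>
  consider "\<not> right_wins_first (G \<oplus> int_game 0)"
    | "\<not> right_wins_first (conjugate G \<oplus> int_game 0)"
    | "outcome (G \<oplus> int_game 0) = N_outcome"
    using wins_first_conjugate(2) [of "G \<oplus> int_game 0"]
    unfolding conjugate_gsum zero outcome_def by argo
  then show "\<exists>n. ntp G = Some n"
    unfolding ntp_def ex_smallest_iff gsum_conjugate_eq outcome_conjugate
    using ex_outcome_N by cases blast+
qed

end
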